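(* There exists an integral domain $D$ such that $\operatorname{Int}(D)$ does not admit any $D$-$D$-biring structure for which the inclusion $D[X]\to\operatorname{Int}(D)$ is a homomorphism of $D$-$D$-birings.
   Context: For an integral domain $D$ with field of fractions $K$, $\operatorname{Int}(D)=\{f\in K[X]: f(D)\subseteq D\}$ is the ring of integer-valued polynomials on $D$; it is a $D$-algebra containing $D[X]$. All algebras are commutative with identity. A $D$-$D$-biring is a $D$-algebra $A$ together with a lift of the covariant functor $\operatorname{Hom}_{D\text{-alg}}(A,-)$ from $D$-algebras to sets to a functor from $D$-algebras to $D$-algebras; that is, for each $D$-algebra $B$ a $D$-algebra structure on the set $\operatorname{Hom}_{D\text{-alg}}(A,B)$, natural in $B$. Equivalently (by Yoneda), $A$ carries $D$-algebra homomorphisms $\Delta^{+},\Delta^{\times}\colon A\to A\otimes_D A$ (coaddition and comultiplication), an additive antipode $A\to A$, a cozero and a counit $A\to D$, and a co-$D$-linear structure given by a $D$-algebra homomorphism $A\to D$ for each element of $D$, satisfying the duals of the commutative $D$-algebra axioms. A homomorphism of $D$-$D$-birings $A\to A'$ is a $D$-algebra homomorphism such that, for every $D$-algebra $B$, the induced map $\operatorname{Hom}_{D\text{-alg}}(A',B)\to\operatorname{Hom}_{D\text{-alg}}(A,B)$ is a $D$-algebra homomorphism (equivalently, it is compatible with all the co-operations). The polynomial ring $D[X]$ is regarded as a $D$-$D$-biring in the standard way: it represents the identity functor, via $\operatorname{Hom}_{D\text{-alg}}(D[X],B)\cong B$, $\varphi\mapsto\varphi(X)$. In particular $\Delta^{+}(X)=X\otimes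 1+1\otimes X$ and $\Delta^{\times}(X)=X\otimes X$. *)

theory Defs
  imports "HOL-Algebra.UnivPoly" "HOL-Algebra.Subrings"
begin

section \<open>Homomorphisms of algebras over a commutative ring\<close>

text \<open>
  A \<open>D\<close>-algebra is a record \<open>B\<close> with \<^term>\<open>algebra D B\<close>; this is the library's notion, in which both
  \<open>D\<close> and \<open>B\<close> are commutative with identity.  Homomorphisms are made extensional so that two of
  them are equal as HOL functions iff they agree on the carrier; thus \<open>alg_hom D A B\<close> is the
  set of homomorphisms itself and can serve as the carrier of an algebra.
\<close>

definition alg_hom ::
  "('d, 'k) ring_scheme \<Rightarrow> ('d, 'a, 'm) module_scheme \<Rightarrow> ('d, 'b, 'n) module_scheme \<Rightarrow> ('a \<Rightarrow> 'b) set"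
  where "alg_hom D A B =
    {h \<in> ring_hom A B \<inter> extensional (carrier A).
       \<forall>d\<in>carrier D. \<forall>a\<in>carrier A. h (d \<odot>\<^bsub>A\<^esub> a) = d \<odot>\<^bsub>B\<^esub> h a}"

section \<open>Birings\<close>

text \<open>
  A \<open>D\<close>-\<open>D\<close>-biring is a \<open>D\<close>-algebra \<open>A\<close> with a lift \<open>S\<close> of the functor \<open>Hom(A,-)\<close>: to each
  \<open>D\<close>-algebra \<open>B\<close> it assigns a \<open>D\<close>-algebra \<open>S B\<close> with carrier \<open>Hom(A,B)\<close>, in such a way that
  composition with a homomorphism \<open>B \<rightarrow> C\<close> is a homomorphism \<open>S B \<rightarrow> S C\<close>.

  The algebras \<open>B\<close> range over those whose carrier is a subset of the type \<open>'b\<close>, which plays the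
  role of a universe.  If that type contains isomorphic copies of \<open>A\<close> and of its two- and threefold
  tensor powers over \<open>D\<close>, Yoneda's lemma turns such a lift into co-operations on \<open>A\<close>, hence
  extends it uniquely to algebras of any size.  For \<open>A\<close> a ring of polynomials over a field with
  elements in \<open>'b\<close>, this is the case as soon as \<open>'b\<close> is infinite.
\<close>

definition biring ::
  "('d, 'k) ring_scheme \<Rightarrow> ('d, 'a, 'm) module_scheme
    \<Rightarrow> (('d, 'b) module \<Rightarrow> ('d, 'a \<Rightarrow> 'b) module) \<Rightarrow> bool"
  where "biring D A S \<longleftrightarrow>
    algebra D A \<and>
    (\<forall>B. algebra D B \<longrightarrow> algebra D (S B) \<and> carrier (S B) = alg_hom D A B) \<and>
    (\<forall>B C. \<forall>\<phi>\<in>alg_hom D B C. algebra D B \<longrightarrow> algebra D C \<longrightarrow>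
       (\<lambda>h\<in>alg_hom D A B. compose (carrier A) \<phi> h) \<in> alg_hom D (S B) (S C))"

definition biring_hom ::
  "('d, 'k) ring_scheme
    \<Rightarrow> ('d, 'a, 'm) module_scheme \<Rightarrow> (('d, 'b) module \<Rightarrow> ('d, 'a \<Rightarrow> 'b) module)
    \<Rightarrow> ('d, 'c, 'n) module_scheme \<Rightarrow> (('d, 'b) module \<Rightarrow> ('d, 'c \<Rightarrow> 'b) module)
    \<Rightarrow> ('a \<Rightarrow> 'c) \<Rightarrow> bool"
  where "biring_hom D A S A' S' j \<longleftrightarrow>
    j \<in> alg_hom D A A' \<and>
    (\<forall>B. algebra D B \<longrightarrow>
       (\<lambda>h\<in>alg_hom D A' B. compose (carrier A) h j) \<in> alg_hom D (S' B) (S B))"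

text \<open>
  The standard biring structure on \<open>D[X]\<close>: the \<open>D\<close>-algebra structure of \<open>B\<close> is transported to
  \<open>Hom(D[X],B)\<close> along the bijection \<open>\<phi> \<mapsto> \<phi>(X)\<close>.
\<close>

definition poly_lift ::
  "('d, 'k) ring_scheme \<Rightarrow> ('d, 'b) module \<Rightarrow> ('d, (nat \<Rightarrow> 'd) \<Rightarrow> 'b) module"
  where "poly_lift D B =
    (let ev = (\<lambda>\<phi>. \<phi> (monom (UP D) \<one>\<^bsub>D\<^esub> 1));
         hm = the_inv_into (alg_hom D (UP D) B) ev
     in \<lparr>carrier = alg_hom D (UP D) B,
         monoid.mult = (\<lambda>\<phi> \<psi>. hm (ev \<phi> \<otimes>\<^bsub>B\<^esub> ev \<psi>)),
         monoid.one = hm \<one>\<^bsub>B\<^esub>,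
         zero = hm \<zero>\<^bsub>B\<^esub>,
         add = (\<lambda>\<phi> \<psi>. hm (ev \<phi> \<oplus>\<^bsub>B\<^esub> ev \<psi>)),
         smult = (\<lambda>d \<phi>. hm (d \<odot>\<^bsub>B\<^esub> ev \<phi>))\<rparr>)"

section \<open>Integer-valued polynomials\<close>

definition field_of_fractions :: "'u ring \<Rightarrow> 'u ring \<Rightarrow> bool"
  where "field_of_fractions D K \<longleftrightarrow>
    field K \<and> subring (carrier D) K \<and> D = K\<lparr>carrier := carrier D\<rparr> \<and>
    (\<forall>x\<in>carrier K. \<exists>a\<in>carrier D. \<exists>b\<in>carrier D - {\<zero>\<^bsub>D\<^esub>}. x = a \<otimes>\<^bsub>K\<^esub> inv\<^bsub>K\<^esub> b)"

text \<open>
  \<open>Int(D)\<close> as a subalgebra of \<open>K[X]\<close>, where \<open>K\<close> is the field of fractions of \<open>D\<close>.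
\<close>

definition int_valued :: "'u ring \<Rightarrow> 'u ring \<Rightarrow> ('u, nat \<Rightarrow> 'u) up_ring"
  where "int_valued D K = (UP K)\<lparr>carrier :=
    {f \<in> carrier (UP K). \<forall>x\<in>carrier D. eval K K id x f \<in> carrier D}\<rparr>"

text \<open>
  Elements of \<^term>\<open>carrier (UP D)\<close> are coefficient sequences, so for \<open>D\<close> a subring of \<open>K\<close> the
  inclusion \<open>D[X] \<rightarrow> Int(D)\<close> is the identity on them.
\<close>

definition poly_incl :: "'u ring \<Rightarrow> (nat \<Rightarrow> 'u) \<Rightarrow> (nat \<Rightarrow> 'u)"
  where "poly_incl D = (\<lambda>p\<in>carrier (UP D). p)"

end

theory Submission
  imports Defs "HOL-Computational_Algebra.Polynomial_Factorial" "HOL-Library.Countable_Set"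
begin

text \<open>
  If \<open>Int(D)\<close> carries a biring structure extending that of \<open>D[X]\<close>, then for every \<open>D\<close>-algebra \<open>B\<close>
  the elements \<open>b\<close> of \<open>B\<close> that are images of \<open>X\<close> under some homomorphism \<open>Int(D) \<rightarrow> B\<close> are closed
  under addition (\<open>biring_sum_at_X\<close>): addition of homomorphisms in \<open>Hom(Int(D),B)\<close> restricts to
  addition in \<open>Hom(D[X],B)\<close>, which is addition in \<open>B\<close>.  So it suffices to find \<open>D\<close> and \<open>B\<close> for which
  this fails.

  Let \<open>V\<close> be the localization of \<open>\<int>[s]\<close> at the prime \<open>3\<close>, with fraction field \<open>K = \<rat>(s)\<close>, and let
  \<open>D = \<int> + 3V\<close>.  Two facts about \<open>Int(D)\<close> conflict.  On the one hand, \<open>g \<in> Int(D)\<close> implies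
  \<open>g'(0) \<in> V\<close> (\<open>linear_coeff_in\<close>).  Indeed \<open>g(3z)\<close> maps \<open>V\<close> into \<open>\<int> + 3V\<close>, so modulo \<open>3V\<close> it takes only
  three values, one of them at infinitely many powers of \<open>s\<close>; the differences of these powers are
  units of \<open>V\<close>, so interpolation shows that \<open>g(3z)\<close> is constant modulo \<open>3V\<close>, and its linear
  coefficient \<open>3g'(0)\<close> lies in \<open>3V\<close>.  On the other hand, \<open>f = (X\<^sup>3 - X)\<^sup>2/3\<close> belongs to \<open>Int(D)\<close>
  (\<open>third_of_square_in\<close>), because \<open>x\<^sup>3 - x \<in> 3V\<close> for \<open>x \<in> D\<close>, but \<open>f''(0) = 2/3\<close> is not in \<open>V\<close>.

  Let \<open>B = D + V\<epsilon> + V\<epsilon>' + V\<epsilon>\<epsilon>'\<close> with \<open>\<epsilon>\<^sup>2 = \<epsilon>'\<^sup>2 = 0\<close>.  By the first fact, \<open>g \<mapsto> g(0) + g'(0)\<epsilon>\<close> and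
  \<open>g \<mapsto> g(0) + g'(0)\<epsilon>'\<close> are homomorphisms \<open>Int(D) \<rightarrow> B\<close> (\<open>jet_alg_hom\<close>); they send \<open>X\<close> to \<open>\<epsilon>\<close> and \<open>\<epsilon>'\<close>.
  A homomorphism sending \<open>X\<close> to \<open>\<epsilon> + \<epsilon>'\<close> would send \<open>f\<close> to an element \<open>y\<close> of \<open>B\<close> with
  \<open>3y = (\<epsilon> + \<epsilon>')\<^sup>2 = 2\<epsilon>\<epsilon>'\<close>, which is impossible as \<open>2/3 \<notin> V\<close> (\<open>no_hom_to_diagonal\<close>).

  The field \<open>K\<close> and the ring \<open>B\<close> are countable, so both can be copied into any infinite type.
\<close>

section \<open>Polynomials mapping the integers plus multiples of three to themselves\<close>

text \<open>
  Splitting off the value at one point \<open>c\<close> of \<open>C\<close>, write \<open>p = p(c) + (X - c)q\<close>.  At every other point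
  \<open>x\<close> of \<open>C\<close> the value \<open>q(x) = (p(x) - p(c))/(x - c)\<close> is again in \<open>M\<close>, since \<open>x - c\<close> is invertible in
  \<open>V\<close>, so induction on the degree applies to \<open>q\<close>.
\<close>

lemma coeff_in_if_values_in:
  fixes p :: "'k::field poly"
  assumes diff: "\<And>x y. x \<in> M \<Longrightarrow> y \<in> M \<Longrightarrow> x - y \<in> M"
    and smult: "\<And>v x. v \<in> V \<Longrightarrow> x \<in> M \<Longrightarrow> v * x \<in> M"
    and "infinite C" "C \<subseteq> V"
    and units: "\<And>x y. x \<in> C \<Longrightarrow> y \<in> C \<Longrightarrow> x \<noteq> y \<Longrightarrow> inverse (x - y) \<in> V"
    and values_in: "\<And>c. c \<in> C \<Longrightarrow> poly p c \<in> M"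
  shows "Polynomial.coeff p i \<in> M"
  using \<open>infinite C\<close> \<open>C \<subseteq> V\<close> units values_in
proof (induction "degree p" arbitrary: p C i)
  case 0
  then obtain a where p: "p = [:a:]" by (metis degree_eq_zeroE)
  from \<open>infinite C\<close> obtain c where c: "c \<in> C" by (metis finite.emptyI equals0I)
  have "a \<in> M" using 0(5)[OF c] p by simp
  moreover from diff[OF this this] have "0 \<in> M" by simp
  ultimately show ?case using p by (simp add: coeff_pCons split: nat.splits)
next
  case (Suc n)
  from \<open>infinite C\<close> obtain c where c: "c \<in> C" by (metis finite.emptyI equals0I)
  define q where "q = synthetic_div p c"
  have p: "p = [:-c, 1:] * q + [:poly p c:]"
    unfolding q_def by (rule synthetic_div_correct'[symmetric])
  have "Polynomial.coeff q j \<in> M" for j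
  proof (rule Suc.hyps(1))
    show "n = degree q" using Suc.hyps(2) by (simp add: q_def degree_synthetic_div)
    show "infinite (C - {c})" "C - {c} \<subseteq> V" using Suc.prems by auto
    show "inverse (x - y) \<in> V" if "x \<in> C - {c}" "y \<in> C - {c}" "x \<noteq> y" for x y
      using that Suc.prems(3) by blast
    fix x assume x: "x \<in> C - {c}"
    have "poly p x = (x - c) * poly q x + poly p c"
      by (subst p) (simp add: algebra_simps)
    then have "poly q x = inverse (x - c) * (poly p x - poly p c)"
      using x by (simp add: field_simps)
    then show "poly q x \<in> M"
      using x c diff smult Suc.prems by auto
  qed
  moreover have cV: "c \<in> V" using c Suc.prems by blast
  moreover have "Polynomial.coeff p i = (if i = 0 then poly p c else Polynomial.coeff q (i - 1)) - c * Polynomial.coeff q i"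
    by (subst p) (simp add: coeff_pCons split: nat.splits)
  ultimately show ?case using diff smult Suc.prems(4)[OF c] by (simp split: if_splits)
qed

text \<open>
  What the argument needs of \<open>V\<close>: \<open>3\<close> is not a unit, and there are infinitely many elements whose
  differences are units.  The latter forces every residue field of \<open>V\<close> to be infinite.
\<close>

locale infinite_residue_ring =
  fixes V :: "'k::field set"
  assumes one_in: "1 \<in> V"
    and diff_in: "\<And>x y. x \<in> V \<Longrightarrow> y \<in> V \<Longrightarrow> x - y \<in> V"
    and mult_in: "\<And>x y. x \<in> V \<Longrightarrow> y \<in> V \<Longrightarrow> x * y \<in> V"
    and fraction: "\<And>x. \<exists>a\<in>V. \<exists>b\<in>V. b \<noteq> 0 \<and> x = a / b"
    and third_notin: "inverse 3 \<notin> V"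
    and residues: "\<exists>C\<subseteq>V. infinite C \<and> (\<forall>x\<in>C. \<forall>y\<in>C. x \<noteq> y \<longrightarrow> inverse (x - y) \<in> V)"
begin

lemma zero_in: "0 \<in> V"
  using diff_in[OF one_in one_in] by simp

lemma uminus_in: "x \<in> V \<Longrightarrow> - x \<in> V"
  using diff_in[OF zero_in] by simp

lemma add_in: "x \<in> V \<Longrightarrow> y \<in> V \<Longrightarrow> x + y \<in> V"
  using diff_in[OF _ uminus_in[of y], of x] by simp

lemma of_int_in: "of_int m \<in> V"
proof -
  have "of_nat n \<in> V" for n by (induction n) (auto intro: zero_in one_in add_in)
  then show ?thesis by (cases m) (auto intro: uminus_in simp del: of_nat_Suc)
qed

lemmas ring_intros = zero_in one_in add_in diff_in mult_in uminus_in of_int_in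

lemma three_nonzero: "(3::'k) \<noteq> 0"
  using third_notin zero_in by auto

text \<open>
  The domain \<open>D\<close> is the preimage in \<open>V\<close> of the prime ring of \<open>V/3V\<close>.  Passing to a finite residue
  ring is what makes \<open>Int(D)\<close> larger than \<open>D[X]\<close>.
\<close>

definition base :: "'k set" where
  "base = {of_int m + 3 * v | m v. v \<in> V}"

lemma base_subset: "x \<in> base \<Longrightarrow> x \<in> V"
  using of_int_in[of 3] by (auto simp: base_def intro!: add_in of_int_in mult_in)

lemma base_of_int: "of_int m \<in> base"
  unfolding base_def using zero_in by force

lemma base_three: "v \<in> V \<Longrightarrow> 3 * v \<in> base"
  unfolding base_def by (rule CollectI, rule exI[of _ 0]) auto

lemma base_add: "x \<in> base \<Longrightarrow> y \<in> base \<Longrightarrow> x + y \<in> base"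
proof -
  assume "x \<in> base" "y \<in> base"
  then obtain m v n w where "x = of_int m + 3 * v" "y = of_int n + 3 * w" "v \<in> V" "w \<in> V"
    unfolding base_def by blast
  then have "x + y = of_int (m + n) + 3 * (v + w)" "v + w \<in> V"
    by (auto simp: algebra_simps intro: ring_intros)
  then show ?thesis unfolding base_def by blast
qed

lemma base_uminus: "x \<in> base \<Longrightarrow> - x \<in> base"
proof -
  assume "x \<in> base"
  then obtain m v where "x = of_int m + 3 * v" "v \<in> V"
    unfolding base_def by blast
  then have "- x = of_int (- m) + 3 * (- v)" "- v \<in> V"
    by (auto intro: ring_intros)
  then show ?thesis unfolding base_def by blast
qed

lemma base_mult: "x \<in> base \<Longrightarrow> y \<in> base \<Longrightarrow> x * y \<in> base"
proof -
  assume "x \<in> base" "y \<in> base"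
  then obtain m v n w where "x = of_int m + 3 * v" "y = of_int n + 3 * w" "v \<in> V" "w \<in> V"
    unfolding base_def by blast
  then have "x * y = of_int (m * n) + 3 * (of_int m * w + of_int n * v + of_int 3 * (v * w))"
     "of_int m * w + of_int n * v + of_int 3 * (v * w) \<in> V"
    by (simp add: algebra_simps, intro ring_intros)
  then show ?thesis unfolding base_def by blast
qed

lemma base_fraction: "\<exists>a\<in>base. \<exists>b\<in>base. b \<noteq> 0 \<and> x = a / b"
proof -
  obtain a b where "a \<in> V" "b \<in> V" "b \<noteq> 0" "x = a / b" using fraction by blast
  then have "3 * a \<in> base" "3 * b \<in> base" "3 * b \<noteq> 0" "x = (3 * a) / (3 * b)"
    using three_nonzero by (auto intro: base_three)
  then show ?thesis by blast
qed

text \<open>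
  The polynomial \<open>p(3z)\<close> takes at most three values modulo \<open>3V\<close> on the infinite set \<open>C\<close> of points with
  unit differences, hence agrees with some integer \<open>e\<close> modulo \<open>3V\<close> on an infinite subset; there
  interpolation applies to \<open>p(3z) - e\<close> with \<open>M = 3V\<close>.
\<close>

lemma linear_coeff_in:
  assumes "\<And>x. x \<in> base \<Longrightarrow> poly p x \<in> base"
  shows "Polynomial.coeff p 1 \<in> V"
proof -
  obtain C where C: "C \<subseteq> V" "infinite C"
    "\<And>x y. x \<in> C \<Longrightarrow> y \<in> C \<Longrightarrow> x \<noteq> y \<Longrightarrow> inverse (x - y) \<in> V"
    using residues by blast
  have "\<exists>e\<in>{0..<3}. \<exists>v\<in>V. poly p (3 * c) = of_int e + 3 * v" if "c \<in> C" for c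
  proof -
    have "poly p (3 * c) \<in> base" using assms base_three that C(1) by blast
    then obtain m v where mv: "poly p (3 * c) = of_int m + 3 * v" "v \<in> V"
      unfolding base_def by blast
    have "of_int m = (of_int (3 * (m div 3) + m mod 3) :: 'k)" by simp
    then have "poly p (3 * c) = of_int (m mod 3) + 3 * (of_int (m div 3) + v)"
      using mv(1) by (simp only: of_int_add of_int_mult of_int_numeral) (simp add: algebra_simps)
    moreover have "of_int (m div 3) + v \<in> V" using mv by (intro ring_intros)
    moreover have "m mod 3 \<in> {0..<3}" by simp
    ultimately show ?thesis by blast
  qed
  then obtain r where r: "\<And>c. c \<in> C \<Longrightarrow> r c \<in> {0..<3::int}"
      "\<And>c. c \<in> C \<Longrightarrow> \<exists>v\<in>V. poly p (3 * c) = of_int (r c) + 3 * v"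
    by metis
  have "finite (r ` C)" using r(1) by (meson finite_atLeastLessThan_int finite_subset image_subsetI)
  then obtain c0 where "c0 \<in> C" and inf: "infinite {c \<in> C. r c = r c0}"
    using pigeonhole_infinite[OF C(2)] by blast
  define g where "g = pcompose p [:0, 3:] - [:of_int (r c0):]"
  \<comment> \<open>The linear coefficient of \<open>p(3z)\<close> is three times that of \<open>p\<close>, so \<open>3V\<close> here means \<open>V\<close> for \<open>p\<close>.\<close>
  have "Polynomial.coeff g 1 \<in> (*) 3 ` V"
  proof (rule coeff_in_if_values_in[OF _ _ inf])
    show "x - y \<in> (*) 3 ` V" if xy: "x \<in> (*) 3 ` V" "y \<in> (*) 3 ` V" for x y
    proof -
      from xy obtain v w where vw: "v \<in> V" "w \<in> V" and "x = 3 * v" "y = 3 * w" by blast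
      then have "x - y = 3 * (v - w)" by (simp add: algebra_simps)
      then show ?thesis using diff_in[OF vw] by blast
    qed
    show "v * x \<in> (*) 3 ` V" if v: "v \<in> V" and x: "x \<in> (*) 3 ` V" for v x
    proof -
      from x obtain w where w: "w \<in> V" and "x = 3 * w" by blast
      then have "v * x = 3 * (v * w)" by (simp add: algebra_simps)
      then show ?thesis using mult_in[OF v w] by blast
    qed
    show "poly g c \<in> (*) 3 ` V" if c: "c \<in> {c \<in> C. r c = r c0}" for c
    proof -
      obtain v where "v \<in> V" "poly p (3 * c) = of_int (r c) + 3 * v" using r(2)[of c] c by blast
      moreover have "poly g c = poly p (3 * c) - of_int (r c)"
        using c by (simp add: g_def poly_pcompose mult.commute)
      ultimately have "poly g c = 3 * v" by simp
      then show ?thesis using \<open>v \<in> V\<close> by blast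
    qed
  qed (use C in auto)
  then obtain v where v: "v \<in> V" "Polynomial.coeff g 1 = 3 * v" by blast
  have "Polynomial.coeff g 1 = 3 * Polynomial.coeff p 1"
    by (simp add: g_def coeff_pcompose_linear)
  then show ?thesis using v three_nonzero by simp
qed

text \<open>
  Fermat's little theorem modulo \<open>3\<close> gives \<open>x\<^sup>3 - x \<in> 3V\<close> on \<open>D\<close>, so the square of \<open>x\<^sup>3 - x\<close> lies in \<open>9V\<close>
  and a third of it in \<open>3V \<subseteq> D\<close>.  Without the square, \<open>(X\<^sup>3 - X)/3\<close> maps \<open>D\<close> into \<open>V\<close>
  but not into \<open>D\<close>.
\<close>

lemma third_of_square_in:
  assumes "x \<in> base"
  shows "(x ^ 3 - x)\<^sup>2 / 3 \<in> base"
proof -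
  obtain m v where x: "x = of_int m + 3 * v" "v \<in> V" using assms unfolding base_def by blast
  have "m mod 3 = 0 \<or> m mod 3 = 1 \<or> m mod 3 = 2" by presburger
  then have "m ^ 3 mod 3 = m mod 3" by (subst power_mod[symmetric]) auto
  then have "3 dvd m ^ 3 - m" by (simp add: mod_eq_dvd_iff)
  then obtain k where k: "m ^ 3 - m = 3 * k" by blast
  define w where "w = of_int k + of_int (3 * m ^ 2 - 1) * v + of_int (9 * m) * v * v + of_int 9 * v * v * v"
  have "w \<in> V" unfolding w_def using x(2) by (intro ring_intros)
  have "(of_int m ^ 3 - of_int m :: 'k) = 3 * of_int k"
    using arg_cong[OF k, of of_int] by simp
  then have "x ^ 3 - x = 3 * w"
    unfolding x w_def by (simp add: power2_eq_square power3_eq_cube algebra_simps)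
  then have "(x ^ 3 - x)\<^sup>2 / 3 = 3 * (w * w)"
    using three_nonzero by (simp add: power2_eq_square)
  then show ?thesis using base_three[OF mult_in[OF \<open>w \<in> V\<close> \<open>w \<in> V\<close>]] by (simp only:)
qed

lemma two_thirds_notin: "d \<in> V \<Longrightarrow> 3 * d \<noteq> 2"
proof
  assume d: "d \<in> V" "3 * d = 2"
  then have "inverse 3 = 1 - d" using three_nonzero by (simp add: field_simps)
  then show False using third_notin d one_in diff_in by metis
qed

end

section \<open>The localization of the integer polynomials at three\<close>

definition int_poly_at_3 :: "int poly fract set" where
  "int_poly_at_3 = {Fract a b | a b. \<not> 3 dvd b}"

lemma prime_elem_three: "prime_elem (3 :: int poly)"
proof -
  have "prime_elem [:3::int:]" unfolding prime_elem_const_poly_iff by simp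
  then show ?thesis by (simp add: numeral_poly)
qed

lemma three_dvd_iff: "(3 :: int poly) dvd p \<longleftrightarrow> (\<forall>n. 3 dvd Polynomial.coeff p n)"
  using const_poly_dvd_iff[of "3::int" p] by (simp add: numeral_poly)

text \<open>
  The residue field at \<open>3\<close> is \<open>F(s)\<close> with \<open>F\<close> the field of three elements, in which the
  powers of \<open>s\<close> are distinct; so their differences are units of the localization.
\<close>

lemma infinite_residue_ring_int_poly: "infinite_residue_ring int_poly_at_3"
proof -
  have not_dvd_one: "\<not> 3 dvd (1 :: int poly)"
    by (auto simp: three_dvd_iff)
  then have integral: "Fract c 1 \<in> int_poly_at_3" for c
    unfolding int_poly_at_3_def by blast
  have not_dvd_mult: "\<not> 3 dvd b * d" if "\<not> 3 dvd b" "\<not> 3 dvd d" for b d :: "int poly"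
    using that prime_elem_three by (simp add: prime_elem_dvd_mult_iff)
  show ?thesis
  proof
  show "1 \<in> int_poly_at_3"
    unfolding One_fract_def by (rule integral)
  fix x y assume "x \<in> int_poly_at_3" "y \<in> int_poly_at_3"
  then obtain a b c d where xy: "x = Fract a b" "y = Fract c d" "\<not> 3 dvd b" "\<not> 3 dvd d"
    unfolding int_poly_at_3_def by blast
  then have "b \<noteq> 0" "d \<noteq> 0" by auto
  then have "x - y = Fract (a * d - c * b) (b * d)" "x * y = Fract (a * c) (b * d)"
    using xy by auto
  then show "x - y \<in> int_poly_at_3" "x * y \<in> int_poly_at_3"
    unfolding int_poly_at_3_def using not_dvd_mult xy by blast+
next
  fix x :: "int poly fract"
  obtain a b where x: "x = Fract a b" "b \<noteq> 0" by (cases x)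
  have "x = Fract a 1 / Fract b 1" "Fract b 1 \<noteq> 0" using x by (auto simp: Zero_fract_def eq_fract)
  then show "\<exists>a\<in>int_poly_at_3. \<exists>b\<in>int_poly_at_3. b \<noteq> 0 \<and> x = a / b" using integral by blast

  have three: "(3::int poly fract) = Fract 3 1"
    using of_nat_fract[of 3, where 'a="int poly"] by simp
  show "inverse (3::int poly fract) \<notin> int_poly_at_3"
  proof
    assume "inverse (3::int poly fract) \<in> int_poly_at_3"
    then obtain a b :: "int poly" where ab: "Fract 1 3 = Fract a b" "\<not> 3 dvd b"
      unfolding int_poly_at_3_def three by auto
    then have "b = a * 3" by (subst (asm) eq_fract) auto
    then show False using ab by simp
  qed
next
  define s :: "nat \<Rightarrow> int poly fract" where "s i = Fract (Polynomial.monom 1 i) 1" for i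
  have sub: "s ` UNIV \<subseteq> int_poly_at_3"
    unfolding s_def using integral by blast
  have "inj s"
    by (auto simp: inj_def s_def eq_fract monom_eq_iff')
  have "inverse (s i - s j) \<in> int_poly_at_3" if "i \<noteq> j" for i j
  proof -
    have "\<not> 3 dvd (Polynomial.monom 1 i - Polynomial.monom 1 j :: int poly)"
      using that by (auto simp: three_dvd_iff intro!: exI[of _ i])
    moreover have "inverse (s i - s j) = Fract 1 (Polynomial.monom 1 i - Polynomial.monom 1 j)"
      by (simp add: s_def)
    ultimately show ?thesis unfolding int_poly_at_3_def by blast
  qed
  then have "inverse (x - y) \<in> int_poly_at_3" if "x \<in> range s" "y \<in> range s" "x \<noteq> y" for x y
    using that by (elim rangeE) (metis (no_types))
  then show "\<exists>C\<subseteq>int_poly_at_3. infinite C \<and>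
      (\<forall>x\<in>C. \<forall>y\<in>C. x \<noteq> y \<longrightarrow> inverse (x - y) \<in> int_poly_at_3)"
    using sub range_inj_infinite[OF \<open>inj s\<close>]
    by (intro exI[of _ "range s"] conjI ballI impI)
  qed
qed

lemma countable_poly: "countable (UNIV :: 'a::{zero,countable} poly set)"
proof (rule countableI)
  show "inj (\<lambda>p :: 'a poly. to_nat (coeffs p))"
    by (metis (no_types, lifting) injI coeffs_eq_iff inj_to_nat inj_eq)
qed

lemma countable_fract:
  assumes "countable (UNIV :: 'a::idom set)"
  shows "countable (UNIV :: 'a fract set)"
proof -
  have "(UNIV :: 'a fract set) = (\<lambda>(a, b). Fract a b) ` (UNIV \<times> UNIV)"
  proof (rule UNIV_eq_I)
    fix x :: "'a fract" obtain a b where "x = Fract a b" by (cases x)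
    then show "x \<in> (\<lambda>(a, b). Fract a b) ` (UNIV \<times> UNIV)" by force
  qed
  then show ?thesis using assms by (metis countable_SIGMA countable_image)
qed

section \<open>Sums of homomorphisms out of a biring\<close>

lemma alg_hom_closed: "h \<in> alg_hom D A B \<Longrightarrow> a \<in> carrier A \<Longrightarrow> h a \<in> carrier B"
  unfolding alg_hom_def using ring_hom_closed by fastforce

lemma algebra_structure_hom:
  assumes "algebra D B"
  shows "ring_hom_cring D B (\<lambda>d. d \<odot>\<^bsub>B\<^esub> \<one>\<^bsub>B\<^esub>)"
proof -
  interpret algebra D B by fact
  have "(\<lambda>d. d \<odot>\<^bsub>B\<^esub> \<one>\<^bsub>B\<^esub>) \<in> ring_hom D B"
  proof (rule ring_hom_memI)
    fix c d assume cd: "c \<in> carrier D" "d \<in> carrier D"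
    show "(c \<otimes>\<^bsub>D\<^esub> d) \<odot>\<^bsub>B\<^esub> \<one>\<^bsub>B\<^esub> = (c \<odot>\<^bsub>B\<^esub> \<one>\<^bsub>B\<^esub>) \<otimes>\<^bsub>B\<^esub> (d \<odot>\<^bsub>B\<^esub> \<one>\<^bsub>B\<^esub>)"
      using cd by (simp add: smult_assoc1 smult_assoc2)
  qed (auto simp: smult_l_distr)
  then show ?thesis
    by (intro ring_hom_cringI R.cring_axioms is_cring)
qed

lemma poly_alg_hom_eqI:
  assumes B: "algebra D B"
    and \<phi>: "\<phi> \<in> alg_hom D (UP D) B" and \<psi>: "\<psi> \<in> alg_hom D (UP D) B"
    and X: "\<phi> (up_ring.monom (UP D) \<one>\<^bsub>D\<^esub> 1) = \<psi> (up_ring.monom (UP D) \<one>\<^bsub>D\<^esub> 1)"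
  shows "\<phi> = \<psi>"
proof -
  interpret algebra D B by fact
  interpret UP_pre_univ_prop D B "\<lambda>d. d \<odot>\<^bsub>B\<^esub> \<one>\<^bsub>B\<^esub>" "UP D"
    using algebra_structure_hom[OF B] R.cring_axioms
    by (auto intro: UP_pre_univ_prop.intro UP_cring.intro)
  have const: "\<chi> (up_ring.monom (UP D) r 0) = r \<odot>\<^bsub>B\<^esub> \<one>\<^bsub>B\<^esub>"
    if \<chi>: "\<chi> \<in> alg_hom D (UP D) B" and r: "r \<in> carrier D" for \<chi> r
  proof -
    have "up_ring.monom (UP D) r 0 = r \<odot>\<^bsub>UP D\<^esub> \<one>\<^bsub>UP D\<^esub>"
      using r by (metis P.r_one UP_one_closed monom_mult_is_smult monom_closed)
    then show ?thesis using \<chi> r by (auto simp: alg_hom_def ring_hom_one)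
  qed
  have hom: "ring_hom_cring (UP D) B \<chi>" if "\<chi> \<in> alg_hom D (UP D) B" for \<chi>
    using that by (auto simp: alg_hom_def intro: ring_homD)
  have "\<phi> p = \<psi> p" if p: "p \<in> carrier (UP D)" for p
  proof (rule UP_hom_unique[OF hom[OF \<phi>] _ const[OF \<phi>] hom[OF \<psi>] _ const[OF \<psi>] p])
    show "\<phi> (up_ring.monom (UP D) \<one>\<^bsub>D\<^esub> (Suc 0)) = \<psi> (up_ring.monom (UP D) \<one>\<^bsub>D\<^esub> (Suc 0))"
      using X by simp
    show "\<psi> (up_ring.monom (UP D) \<one>\<^bsub>D\<^esub> (Suc 0)) \<in> carrier B"
      by (rule alg_hom_closed[OF \<psi>]) simp
  qed simp_all
  then show ?thesis
    using \<phi> \<psi> unfolding alg_hom_def by (intro extensionalityI[of _ "carrier (UP D)"]) blast+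
qed

lemma poly_alg_hom_exists:
  assumes B: "algebra D B" and b: "b \<in> carrier B"
  shows "\<exists>\<phi>\<in>alg_hom D (UP D) B. \<phi> (up_ring.monom (UP D) \<one>\<^bsub>D\<^esub> 1) = b"
proof -
  interpret algebra D B by fact
  let ?h = "\<lambda>d. d \<odot>\<^bsub>B\<^esub> \<one>\<^bsub>B\<^esub>"
  interpret UP_pre_univ_prop D B ?h "UP D"
    using algebra_structure_hom[OF B] R.cring_axioms
    by (auto intro: UP_pre_univ_prop.intro UP_cring.intro)
  have hom: "eval D B ?h b \<in> ring_hom (UP D) B" using b by (rule eval_ring_hom)
  have "eval D B ?h b (d \<odot>\<^bsub>UP D\<^esub> p) = d \<odot>\<^bsub>B\<^esub> eval D B ?h b p"
    if d: "d \<in> carrier D" and p: "p \<in> carrier (UP D)" for d p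
  proof -
    have "eval D B ?h b (d \<odot>\<^bsub>UP D\<^esub> p) = eval D B ?h b (up_ring.monom (UP D) d 0 \<otimes>\<^bsub>UP D\<^esub> p)"
      using d p by (simp add: monom_mult_is_smult)
    also have "\<dots> = ?h d \<otimes>\<^bsub>B\<^esub> eval D B ?h b p"
      using d p b by (simp add: ring_hom_mult[OF hom] eval_const)
    also have "\<dots> = d \<odot>\<^bsub>B\<^esub> eval D B ?h b p"
      using d ring_hom_closed[OF hom p] algebra.smult_assoc2[OF B, of d "\<one>\<^bsub>B\<^esub>"] by simp
    finally show ?thesis .
  qed
  then have "eval D B ?h b \<in> alg_hom D (UP D) B"
    using hom eval_extensional by (auto simp: alg_hom_def)
  then show ?thesis using eval_monom1[OF b] by blast
qed

text \<open>
  The lift on \<open>D[X]\<close> is defined through the inverse of evaluation at \<open>X\<close>; this is a genuine inverse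
  because \<open>D[X]\<close> is free on \<open>X\<close>, by the two preceding lemmas.
\<close>

lemma poly_lift_add_at_X:
  assumes B: "algebra D B"
    and \<phi>: "\<phi> \<in> alg_hom D (UP D) B" and \<psi>: "\<psi> \<in> alg_hom D (UP D) B"
  shows "(\<phi> \<oplus>\<^bsub>poly_lift D B\<^esub> \<psi>) (up_ring.monom (UP D) \<one>\<^bsub>D\<^esub> 1) =
    \<phi> (up_ring.monom (UP D) \<one>\<^bsub>D\<^esub> 1) \<oplus>\<^bsub>B\<^esub> \<psi> (up_ring.monom (UP D) \<one>\<^bsub>D\<^esub> 1)"
proof -
  interpret algebra D B by fact
  interpret UP_cring D "UP D" using R.cring_axioms by (auto intro: UP_cring.intro)
  let ?ev = "\<lambda>\<phi>. \<phi> (up_ring.monom (UP D) \<one>\<^bsub>D\<^esub> 1)"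
  have inj: "inj_on ?ev (alg_hom D (UP D) B)"
    using poly_alg_hom_eqI[OF B] by (auto simp: inj_on_def)
  have "?ev \<chi> \<in> carrier B" if "\<chi> \<in> alg_hom D (UP D) B" for \<chi>
    by (rule alg_hom_closed[OF that]) simp
  then have "?ev \<phi> \<oplus>\<^bsub>B\<^esub> ?ev \<psi> \<in> carrier B" using \<phi> \<psi> by simp
  from poly_alg_hom_exists[OF B this]
  have "?ev \<phi> \<oplus>\<^bsub>B\<^esub> ?ev \<psi> \<in> ?ev ` alg_hom D (UP D) B" by (elim bexE) (rule image_eqI, rule sym)
  note at_X = f_the_inv_into_f[OF inj this]
  have "\<phi> \<oplus>\<^bsub>poly_lift D B\<^esub> \<psi> =
    the_inv_into (alg_hom D (UP D) B) ?ev (?ev \<phi> \<oplus>\<^bsub>B\<^esub> ?ev \<psi>)"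
    unfolding poly_lift_def Let_def by simp
  then show ?thesis using at_X by (simp only:)
qed

text \<open>
  The homomorphism \<open>h\<close> is the sum of \<open>h1\<close> and \<open>h2\<close> in the lifted algebra \<open>Hom(A,B)\<close>; restriction along
  \<open>j\<close> turns it into the sum in \<open>Hom(D[X],B) = B\<close>.
\<close>

lemma biring_sum_at_X:
  fixes B :: "('d, 'b) module" and S :: "('d, 'b) module \<Rightarrow> ('d, 'a \<Rightarrow> 'b) module"
  assumes S: "biring D A S" and j: "biring_hom D (UP D) (poly_lift D) A S j"
    and B: "algebra D B"
    and h1: "h1 \<in> alg_hom D A B" and h2: "h2 \<in> alg_hom D A B"
  defines "X \<equiv> j (up_ring.monom (UP D) \<one>\<^bsub>D\<^esub> 1)"
  shows "\<exists>h\<in>alg_hom D A B. h X = h1 X \<oplus>\<^bsub>B\<^esub> h2 X"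
proof -
  interpret B: algebra D B by fact
  interpret UP_cring D "UP D" using B.R.cring_axioms by (auto intro: UP_cring.intro)
  have SB: "algebra D (S B)" and carrier: "carrier (S B) = alg_hom D A B"
    using S B by (auto simp: biring_def)
  interpret SB: algebra D "S B" by fact
  let ?r = "\<lambda>h\<in>alg_hom D A B. compose (carrier (UP D)) h j"
  have r: "?r \<in> alg_hom D (S B) (poly_lift D B)"
    using j B by (simp add: biring_hom_def)
  define h where "h = h1 \<oplus>\<^bsub>S B\<^esub> h2"
  have h: "h \<in> alg_hom D A B"
    unfolding h_def carrier[symmetric] using h1 h2 by (intro SB.a_closed) (simp_all add: carrier)
  have at_X: "(?r k) (up_ring.monom (UP D) \<one>\<^bsub>D\<^esub> 1) = k X" if "k \<in> alg_hom D A B" for k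
    using that by (simp add: compose_def X_def)
  have closed: "?r k \<in> alg_hom D (UP D) B" if "k \<in> alg_hom D A B" for k
    using alg_hom_closed[OF r, of k] that carrier by (simp add: poly_lift_def Let_def)
  have "?r h = ?r h1 \<oplus>\<^bsub>poly_lift D B\<^esub> ?r h2"
    unfolding h_def using r h1 h2 carrier
    by (intro ring_hom_add[of ?r "S B"]) (auto simp: alg_hom_def[of D "S B"])
  then have "(?r h) (up_ring.monom (UP D) \<one>\<^bsub>D\<^esub> 1) =
    (?r h1) (up_ring.monom (UP D) \<one>\<^bsub>D\<^esub> 1) \<oplus>\<^bsub>B\<^esub> (?r h2) (up_ring.monom (UP D) \<one>\<^bsub>D\<^esub> 1)"
    using poly_lift_add_at_X[OF B closed[OF h1] closed[OF h2]] by (simp only:)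
  then have "h X = h1 X \<oplus>\<^bsub>B\<^esub> h2 X"
    unfolding at_X[OF h] at_X[OF h1] at_X[OF h2] .
  then show ?thesis using h by blast
qed

section \<open>Copying a field into another type\<close>

text \<open>
  An injection \<open>e\<close> copies a field given as a type into a record whose carrier lies in the target type.
\<close>

locale transported_field =
  fixes e :: "'k::field \<Rightarrow> 'u"
  assumes inj_e: "inj e"
begin

abbreviation e' :: "'u \<Rightarrow> 'k" where "e' \<equiv> the_inv e"

lemma e'_e [simp]: "e' (e x) = x"
  by (rule the_inv_f_f[OF inj_e])

lemma e_eq_iff [simp]: "e x = e y \<longleftrightarrow> x = y"
  using inj_e by (simp add: inj_eq)

definition K :: "'u ring" where
  "K = \<lparr>carrier = range e, monoid.mult = \<lambda>x y. e (e' x * e' y), one = e 1,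
        zero = e 0, add = \<lambda>x y. e (e' x + e' y)\<rparr>"

lemma K_simps [simp]:
  "carrier K = range e" "e x \<otimes>\<^bsub>K\<^esub> e y = e (x * y)" "\<one>\<^bsub>K\<^esub> = e 1"
  "\<zero>\<^bsub>K\<^esub> = e 0" "e x \<oplus>\<^bsub>K\<^esub> e y = e (x + y)"
  by (simp_all add: K_def)

lemma cring_K: "cring K"
proof (rule cringI)
  show "abelian_group K"
  proof (rule abelian_groupI)
    show "\<exists>y\<in>carrier K. y \<oplus>\<^bsub>K\<^esub> x = \<zero>\<^bsub>K\<^esub>" if "x \<in> carrier K" for x
    proof -
      from that obtain a where "x = e a" by auto
      then show ?thesis by (intro bexI[of _ "e (- a)"]) auto
    qed
  qed (auto simp: algebra_simps)
  show "comm_monoid K"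
    by (rule comm_monoidI) (auto simp: algebra_simps)
qed (auto simp: algebra_simps)

lemma field_K: "field K"
proof -
  interpret cring K by (rule cring_K)
  show ?thesis
  proof (rule cring_fieldI2)
    show "\<exists>b\<in>carrier K. a \<otimes>\<^bsub>K\<^esub> b = \<one>\<^bsub>K\<^esub>" if "a \<in> carrier K" "a \<noteq> \<zero>\<^bsub>K\<^esub>" for a
    proof -
      from that obtain x where "a = e x" "x \<noteq> 0" by auto
      then show ?thesis by (intro bexI[of _ "e (inverse x)"]) auto
    qed
  qed simp
qed

sublocale K: field K by (rule field_K)

lemma K_inv: "x \<noteq> 0 \<Longrightarrow> inv\<^bsub>K\<^esub> (e x) = e (inverse x)"
  by (rule K.comm_inv_char) auto

lemma K_uminus: "\<ominus>\<^bsub>K\<^esub> (e x) = e (- x)"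
  by (rule K.sum_zero_eq_neg[symmetric]) auto

lemma K_pow [simp]: "e x [^]\<^bsub>K\<^esub> (n::nat) = e (x ^ n)"
  by (induction n) (simp_all add: mult.commute)

lemma K_finsum: "finite A \<Longrightarrow> (\<Oplus>\<^bsub>K\<^esub>i\<in>A. e (f i)) = e (sum f A)"
  by (induction A rule: finite_induct) auto

text \<open>
  Polynomials over the copy are the images of polynomials over the original field, with all
  operations and evaluation preserved; this allows computing with the latter.
\<close>

definition up_of :: "'k poly \<Rightarrow> nat \<Rightarrow> 'u" where
  "up_of p = (\<lambda>i. e (Polynomial.coeff p i))"

lemma up_of_in_up: "up_of p \<in> up K"
  by (rule mem_upI) (auto simp: up_of_def bound_def intro: exI[of _ "degree p"] coeff_eq_0)

lemma carrier_UP_K: "carrier (UP K) = range up_of"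
proof -
  have "f \<in> range up_of" if f: "f \<in> up K" for f
  proof -
    obtain n where n: "\<And>i. n < i \<Longrightarrow> f i = e 0"
      using f by (auto simp: up_def bound_def)
    have fi: "f i \<in> range e" for i using mem_upD[OF f] by simp
    have "Polynomial.coeff (Abs_poly (\<lambda>i. e' (f i))) = (\<lambda>i. e' (f i))"
      by (rule coeff_Abs_poly[of n]) (simp add: n)
    moreover have "e (e' (f i)) = f i" for i using fi[of i] by auto
    ultimately have "f = up_of (Abs_poly (\<lambda>i. e' (f i)))" by (simp add: up_of_def)
    then show ?thesis by blast
  qed
  then show ?thesis using up_of_in_up by (auto simp: UP_def)
qed

lemma up_of_closed [simp]: "up_of p \<in> carrier (UP K)"
  by (simp add: carrier_UP_K)

lemma up_of_add: "up_of p \<oplus>\<^bsub>UP K\<^esub> up_of q = up_of (p + q)"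
  using up_of_in_up[of p] up_of_in_up[of q] by (simp add: UP_def) (simp add: up_of_def)

lemma up_of_mult: "up_of p \<otimes>\<^bsub>UP K\<^esub> up_of q = up_of (p * q)"
  using up_of_in_up[of p] up_of_in_up[of q]
  by (simp add: UP_def) (simp add: up_of_def K_finsum Polynomial.coeff_mult)

lemma up_of_one: "\<one>\<^bsub>UP K\<^esub> = up_of 1"
  by (rule ext) (simp add: UP_def up_of_def)

lemma up_of_smult: "e a \<odot>\<^bsub>UP K\<^esub> up_of p = up_of (Polynomial.smult a p)"
  using up_of_in_up[of p] by (simp add: UP_def) (simp add: up_of_def)

lemma eval_up_of: "eval K K id (e x) (up_of p) = e (poly p x)"
proof -
  have coeff: "up_ring.coeff (UP K) (up_of p) i = e (Polynomial.coeff p i)" for i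
    using up_of_in_up[of p] by (simp add: UP_def) (simp add: up_of_def)
  have "deg K (up_of p) = degree p"
    by (simp add: deg_def bound_def coeff degree_def)
  then have "eval K K id (e x) (up_of p) =
      (\<Oplus>\<^bsub>K\<^esub>i\<in>{..degree p}. e (Polynomial.coeff p i * x ^ i))"
    by (simp add: eval_def coeff)
  also have "\<dots> = e (poly p x)"
    by (simp only: K_finsum finite_atMost poly_altdef)
  finally show ?thesis .
qed

definition sub :: "'k set \<Rightarrow> 'u ring" where
  "sub A = K\<lparr>carrier := e ` A\<rparr>"

lemma sub_simps [simp]:
  "carrier (sub A) = e ` A" "monoid.mult (sub A) = monoid.mult K" "\<one>\<^bsub>sub A\<^esub> = \<one>\<^bsub>K\<^esub>"
  "\<zero>\<^bsub>sub A\<^esub> = \<zero>\<^bsub>K\<^esub>" "add (sub A) = add K"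
  by (simp_all add: sub_def)

lemma carrier_int_valued:
  "up_of p \<in> carrier (int_valued (sub A) K) \<longleftrightarrow> (\<forall>x\<in>A. poly p x \<in> A)"
  by (auto simp: int_valued_def eval_up_of)

lemma int_valued_simps [simp]:
  "monoid.mult (int_valued (sub A) K) = monoid.mult (UP K)"
  "\<one>\<^bsub>int_valued (sub A) K\<^esub> = \<one>\<^bsub>UP K\<^esub>"
  "add (int_valued (sub A) K) = add (UP K)"
  "module.smult (int_valued (sub A) K) = module.smult (UP K)"
  by (simp_all add: int_valued_def)

lemma int_valuedE:
  assumes "f \<in> carrier (int_valued (sub A) K)"
  obtains p where "f = up_of p" "\<forall>x\<in>A. poly p x \<in> A"
  using assms carrier_UP_K carrier_int_valued by (auto simp: int_valued_def eval_up_of)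

end

section \<open>Homomorphisms along two square-zero directions\<close>

text \<open>
  The quadruple \<open>(a, b, c, d)\<close> stands for \<open>a + b\<epsilon> + c\<epsilon>' + d\<epsilon>\<epsilon>'\<close> in \<open>K[\<epsilon>,\<epsilon>']\<close> with \<open>\<epsilon>\<^sup>2 = \<epsilon>'\<^sup>2 = 0\<close>.
\<close>

fun qadd :: "('k::field \<times> 'k \<times> 'k \<times> 'k) \<Rightarrow> _ \<Rightarrow> _" where
  "qadd (a, b, c, d) (a', b', c', d') = (a + a', b + b', c + c', d + d')"

fun qmult :: "('k::field \<times> 'k \<times> 'k \<times> 'k) \<Rightarrow> _ \<Rightarrow> _" where
  "qmult (a, b, c, d) (a', b', c', d') =
    (a * a', a * b' + b * a', a * c' + c * a', a * d' + b * c' + c * b' + d * a')"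

fun qscale :: "'k::field \<Rightarrow> ('k \<times> 'k \<times> 'k \<times> 'k) \<Rightarrow> _" where
  "qscale r (a, b, c, d) = (r * a, r * b, r * c, r * d)"

locale counterexample = infinite_residue_ring V + transported_field e
  for V :: "'k::field set" and e :: "'k \<Rightarrow> 'u" +
  fixes \<epsilon> :: "'k \<times> 'k \<times> 'k \<times> 'k \<Rightarrow> 'u"
  assumes inj_\<epsilon>: "inj \<epsilon>"
begin

lemma subring_D: "subring (e ` base) K"
proof (rule K.subringI)
  show "\<one>\<^bsub>K\<^esub> \<in> e ` base" using base_of_int[of 1] by simp
qed (auto simp: K_uminus intro: base_add base_mult base_uminus)

lemma domain_D: "domain (sub base)"
  unfolding sub_def by (rule K.subring_is_domain[OF subring_D])

lemma field_of_fractions_D: "field_of_fractions (sub base) K"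
  unfolding field_of_fractions_def
proof (intro conjI ballI)
  show "sub base = K\<lparr>carrier := carrier (sub base)\<rparr>" by (simp add: sub_def)
  fix x assume "x \<in> carrier K"
  then obtain y where y: "x = e y" by auto
  obtain a b where ab: "a \<in> base" "b \<in> base" "b \<noteq> 0" "y = a / b" using base_fraction by blast
  then have "x = e a \<otimes>\<^bsub>K\<^esub> inv\<^bsub>K\<^esub> (e b)" using y by (simp add: K_inv divide_inverse)
  then show "\<exists>a\<in>carrier (sub base). \<exists>b\<in>carrier (sub base) - {\<zero>\<^bsub>sub base\<^esub>}.
      x = a \<otimes>\<^bsub>K\<^esub> inv\<^bsub>K\<^esub> b"
    by (intro bexI[of _ "e a"] bexI[of _ "e b"]) (use ab in auto)
qed (simp_all add: field_K subring_D)

abbreviation Q :: "('k \<times> 'k \<times> 'k \<times> 'k) set" where "Q \<equiv> base \<times> V \<times> V \<times> V"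

text \<open>
  The coefficient of \<open>\<epsilon>\<epsilon>'\<close> is restricted to \<open>V\<close>, which the product \<open>(b\<epsilon>)(c\<epsilon>')\<close> of elements with
  \<open>b, c \<in> V\<close> respects.  Thus \<open>B\<close> contains the images of both first-order expansions, but has no room
  for the second-order expansion of \<open>(X\<^sup>3 - X)\<^sup>2/3\<close> along \<open>\<epsilon> + \<epsilon>'\<close>.
\<close>

definition B :: "('u, 'u) module" where
  "B = \<lparr>carrier = \<epsilon> ` Q,
        monoid.mult = \<lambda>x y. \<epsilon> (qmult (the_inv \<epsilon> x) (the_inv \<epsilon> y)), one = \<epsilon> (1, 0, 0, 0),
        zero = \<epsilon> (0, 0, 0, 0), add = \<lambda>x y. \<epsilon> (qadd (the_inv \<epsilon> x) (the_inv \<epsilon> y)),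
        module.smult = \<lambda>r x. \<epsilon> (qscale (e' r) (the_inv \<epsilon> x))\<rparr>"

lemma \<epsilon>_eq_iff [simp]: "\<epsilon> x = \<epsilon> y \<longleftrightarrow> x = y"
  using inj_\<epsilon> by (simp add: inj_eq)

lemma B_simps [simp]:
  "carrier B = \<epsilon> ` Q" "\<epsilon> x \<otimes>\<^bsub>B\<^esub> \<epsilon> y = \<epsilon> (qmult x y)" "\<one>\<^bsub>B\<^esub> = \<epsilon> (1, 0, 0, 0)"
  "\<zero>\<^bsub>B\<^esub> = \<epsilon> (0, 0, 0, 0)" "\<epsilon> x \<oplus>\<^bsub>B\<^esub> \<epsilon> y = \<epsilon> (qadd x y)" "e r \<odot>\<^bsub>B\<^esub> \<epsilon> x = \<epsilon> (qscale r x)"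
  by (simp_all add: B_def the_inv_f_f[OF inj_\<epsilon>])

lemma Q_closed:
  assumes "x \<in> Q" "y \<in> Q"
  shows "qadd x y \<in> Q" "qmult x y \<in> Q" "r \<in> base \<Longrightarrow> qscale r x \<in> Q"
proof -
  obtain a b c d a' b' c' d' where xy: "x = (a, b, c, d)" "y = (a', b', c', d')"
    and base: "a \<in> base" "a' \<in> base"
    and V: "b \<in> V" "c \<in> V" "d \<in> V" "b' \<in> V" "c' \<in> V" "d' \<in> V"
    using assms by (cases x, cases y) blast
  note V' = V base[THEN base_subset]
  show "qadd x y \<in> Q" "qmult x y \<in> Q"
    unfolding xy qadd.simps qmult.simps
    by (intro SigmaI base_add base_mult add_in mult_in base V')+
  show "qscale r x \<in> Q" if "r \<in> base"
    unfolding xy qscale.simps using that base_subset[OF that]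
    by (intro SigmaI base_mult mult_in base V')
qed

lemma base_01: "0 \<in> base" "1 \<in> base"
  using base_of_int[of 0] base_of_int[of 1] by simp_all

lemma cring_B: "cring B"
proof (rule cringI)
  show "abelian_group B"
  proof (rule abelian_groupI)
    show "\<exists>y\<in>carrier B. y \<oplus>\<^bsub>B\<^esub> x = \<zero>\<^bsub>B\<^esub>" if "x \<in> carrier B" for x
    proof -
      from that obtain a b c d where "x = \<epsilon> (a, b, c, d)" "(a, b, c, d) \<in> Q" by auto
      then show ?thesis
        by (intro bexI[of _ "\<epsilon> (- a, - b, - c, - d)"]) (auto intro: uminus_in base_uminus)
    qed
    show "x \<oplus>\<^bsub>B\<^esub> y \<in> carrier B" if "x \<in> carrier B" "y \<in> carrier B" for x y
      using that Q_closed(1) by (auto simp del: qadd.simps)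
  qed (auto simp: base_01 zero_in algebra_simps)
  show "comm_monoid B"
  proof (rule comm_monoidI)
    show "x \<otimes>\<^bsub>B\<^esub> y \<in> carrier B" if "x \<in> carrier B" "y \<in> carrier B" for x y
      using that Q_closed(2) by (auto simp del: qmult.simps)
  qed (auto simp: base_01 zero_in algebra_simps)
qed (auto simp: algebra_simps)

lemma algebra_B: "algebra (sub base) B"
proof (rule algebraI)
  show "cring (sub base)" using domain_D by (rule domain.axioms)
  show "cring B" by (rule cring_B)
  show "a \<odot>\<^bsub>B\<^esub> x \<in> carrier B" if "a \<in> carrier (sub base)" "x \<in> carrier B" for a x
  proof -
    from that obtain r q where "a = e r" "r \<in> base" "x = \<epsilon> q" "q \<in> Q" by auto
    moreover from this have "qscale r q \<in> Q" by (intro Q_closed(3))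
    ultimately show ?thesis by (simp only: B_simps imageI)
  qed
qed (auto simp: algebra_simps)

abbreviation "IntD \<equiv> int_valued (sub base) K"

text \<open>
  The first-order expansion \<open>f \<mapsto> f(0) + f'(0)\<delta>\<close> is a homomorphism for every \<open>\<delta>\<close> of square zero, by the
  Leibniz rule; \<open>t a b\<close> encodes \<open>a + b\<delta>\<close>, so that \<open>\<delta> = \<epsilon>\<close> and \<open>\<delta> = \<epsilon>'\<close> are treated together.  That
  it lands in \<open>B\<close> is the integrality of \<open>f'(0)\<close> shown in \<open>linear_coeff_in\<close>.
\<close>

lemma jet_alg_hom:
  assumes emb: "\<And>a b. a \<in> base \<Longrightarrow> b \<in> V \<Longrightarrow> t a b \<in> Q"
    and add: "\<And>a b a' b'. t (a + a') (b + b') = qadd (t a b) (t a' b')"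
    and mult: "\<And>a b a' b'. t (a * a') (a * b' + b * a') = qmult (t a b) (t a' b')"
    and scale: "\<And>r a b. t (r * a) (r * b) = qscale r (t a b)"
    and one: "t 1 0 = (1, 0, 0, 0)"
  shows "(\<lambda>f\<in>carrier IntD. \<epsilon> (t (e' (f 0)) (e' (f 1)))) \<in> alg_hom (sub base) IntD B"
    (is "?h \<in> _")
proof -
  have h: "?h (up_of p) = \<epsilon> (t (Polynomial.coeff p 0) (Polynomial.coeff p 1))"
    if "\<forall>x\<in>base. poly p x \<in> base" for p
    using that by (simp add: carrier_int_valued) (simp add: up_of_def)
  have mem: "t (Polynomial.coeff p 0) (Polynomial.coeff p 1) \<in> Q"
    if p: "\<forall>x\<in>base. poly p x \<in> base" for p
  proof (rule emb)
    show "Polynomial.coeff p 0 \<in> base" using p base_01(1) by (metis poly_0_coeff_0)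
    show "Polynomial.coeff p 1 \<in> V" using p by (intro linear_coeff_in) blast
  qed
  have "?h \<in> ring_hom IntD B"
  proof (rule ring_hom_memI)
    fix f assume "f \<in> carrier IntD"
    then obtain p where p: "f = up_of p" "\<forall>x\<in>base. poly p x \<in> base" by (rule int_valuedE)
    show "?h f \<in> carrier B" unfolding p(1) h[OF p(2)] using mem[OF p(2)] by (simp only: B_simps) (rule imageI)
    fix g assume "g \<in> carrier IntD"
    then obtain q where q: "g = up_of q" "\<forall>x\<in>base. poly q x \<in> base" by (rule int_valuedE)
    have "\<forall>x\<in>base. poly (p * q) x \<in> base" "\<forall>x\<in>base. poly (p + q) x \<in> base"
      using p q by (auto intro: base_mult base_add)
    note hs = h[OF this(1)] h[OF this(2)]
    show "?h (f \<otimes>\<^bsub>IntD\<^esub> g) = ?h f \<otimes>\<^bsub>B\<^esub> ?h g"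
      unfolding p(1) q(1) int_valued_simps up_of_mult hs h[OF p(2)] h[OF q(2)] B_simps mult[symmetric]
      by (simp add: Polynomial.coeff_mult)
    show "?h (f \<oplus>\<^bsub>IntD\<^esub> g) = ?h f \<oplus>\<^bsub>B\<^esub> ?h g"
      unfolding p(1) q(1) int_valued_simps up_of_add hs h[OF p(2)] h[OF q(2)] B_simps add[symmetric]
      by simp
  next
    show "?h \<one>\<^bsub>IntD\<^esub> = \<one>\<^bsub>B\<^esub>"
      unfolding int_valued_simps up_of_one by (subst h) (simp_all add: base_01 one)
  qed
  moreover have "?h (r \<odot>\<^bsub>IntD\<^esub> f) = r \<odot>\<^bsub>B\<^esub> ?h f"
    if "r \<in> carrier (sub base)" "f \<in> carrier IntD" for r f
  proof -
    from that obtain s where s: "r = e s" "s \<in> base" by auto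
    from that obtain p where p: "f = up_of p" "\<forall>x\<in>base. poly p x \<in> base" by (auto elim: int_valuedE)
    have "\<forall>x\<in>base. poly (Polynomial.smult s p) x \<in> base"
      using p s by (auto intro: base_mult)
    note hs = h[OF this]
    show ?thesis
      unfolding p(1) s(1) int_valued_simps up_of_smult hs h[OF p(2)] B_simps scale[symmetric]
      by simp
  qed
  ultimately show ?thesis by (auto simp: alg_hom_def)
qed

text \<open>
  With \<open>u = \<epsilon> + \<epsilon>'\<close> one has \<open>u\<^sup>2 = 2\<epsilon>\<epsilon>'\<close> and \<open>u\<^sup>3 = 0\<close>, so the image \<open>y\<close> of \<open>(X\<^sup>3 - X)\<^sup>2/3\<close> satisfies
  \<open>3y = (u\<^sup>3 - u)\<^sup>2 = 2\<epsilon>\<epsilon>'\<close>, and its last coordinate would be \<open>2/3\<close>.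
\<close>

lemma no_hom_to_diagonal:
  assumes h: "h \<in> alg_hom (sub base) IntD B" and hX: "h (up_of [:0, 1:]) = \<epsilon> (0, 1, 1, 0)"
  shows False
proof -
  define X where "X = up_of [:0, 1:]"
  define p :: "'k poly" where "p = Polynomial.smult (1 / 3) (([:0, 1:] ^ 3 - [:0, 1:])\<^sup>2)"
  have hom: "h \<in> ring_hom IntD B" using h by (simp add: alg_hom_def)
  have mult: "h (up_of (q * r)) = h (up_of q) \<otimes>\<^bsub>B\<^esub> h (up_of r)"
    and add: "h (up_of (q + r)) = h (up_of q) \<oplus>\<^bsub>B\<^esub> h (up_of r)"
    if "up_of q \<in> carrier IntD" "up_of r \<in> carrier IntD" for q r
    using ring_hom_mult[OF hom that] ring_hom_add[OF hom that]
    by (simp_all add: up_of_mult up_of_add)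
  have closed: "up_of (q * r) \<in> carrier IntD" "up_of (q + r) \<in> carrier IntD"
    if "up_of q \<in> carrier IntD" "up_of r \<in> carrier IntD" for q r
    using that unfolding carrier_int_valued by (auto intro: base_mult base_add)
  have X: "up_of [:0, 1:] \<in> carrier IntD" unfolding carrier_int_valued by simp
  define x2 x4 x6 :: "'k poly" where "x2 = [:0, 1:] * [:0, 1:]" and "x4 = x2 * x2" and "x6 = x4 * x2"
  have IntD: "up_of x2 \<in> carrier IntD" "up_of x4 \<in> carrier IntD" "up_of x6 \<in> carrier IntD"
    unfolding x2_def x4_def x6_def by (intro closed X)+
  have h2: "h (up_of x2) = \<epsilon> (0, 0, 0, 2)" unfolding x2_def mult[OF X X] hX by simp
  have h4: "h (up_of x4) = \<epsilon> (0, 0, 0, 0)" unfolding x4_def mult[OF IntD(1,1)] h2 by simp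
  have h6: "h (up_of x6) = \<epsilon> (0, 0, 0, 0)" unfolding x6_def mult[OF IntD(2,1)] h2 h4 by simp
  have p: "up_of p \<in> carrier IntD"
    unfolding carrier_int_valued using third_of_square_in by (simp add: p_def)
  have three: "3 \<in> base" using base_of_int[of 3] by simp
  \<comment> \<open>The expansion of the square, with the negative term moved to the left to avoid subtraction in \<open>Int(D)\<close>.\<close>
  have "(z ^ 3 - z)\<^sup>2 + (z * z * (z * z) + z * z * (z * z)) = z * z * (z * z) * (z * z) + z * z"
    for z :: "'k poly"
    by (simp add: power2_eq_square power3_eq_cube algebra_simps)
  moreover have "Polynomial.smult 3 p = ([:0, 1:] ^ 3 - [:0, 1:])\<^sup>2"
    unfolding p_def smult_smult using three_nonzero by (simp del: mult_pCons_left mult_pCons_right)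
  ultimately have eq: "Polynomial.smult 3 p + (x4 + x4) = x6 + x2"
    unfolding x6_def x4_def x2_def by (simp only:)
  have p3: "up_of (Polynomial.smult 3 p) \<in> carrier IntD"
    using p three unfolding carrier_int_valued poly_smult by (blast intro: base_mult)
  have "h (up_of (Polynomial.smult 3 p)) \<oplus>\<^bsub>B\<^esub> (h (up_of x4) \<oplus>\<^bsub>B\<^esub> h (up_of x4)) =
      h (up_of x6) \<oplus>\<^bsub>B\<^esub> h (up_of x2)"
    unfolding add[OF IntD(2,2), symmetric] add[OF p3 closed(2)[OF IntD(2,2)], symmetric]
      add[OF IntD(3,1), symmetric] eq ..
  moreover have "h (up_of (Polynomial.smult 3 p)) = e 3 \<odot>\<^bsub>B\<^esub> h (up_of p)"
    using h p three unfolding alg_hom_def by (simp add: up_of_smult[symmetric])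
  moreover obtain a b c d where hp: "h (up_of p) = \<epsilon> (a, b, c, d)" "d \<in> V"
    using alg_hom_closed[OF h p] by auto
  ultimately have "3 * d = 2" by (simp add: h2 h4 h6)
  then show False using two_thirds_notin[OF \<open>d \<in> V\<close>] by simp
qed

lemma X_image: "poly_incl (sub base) (up_ring.monom (UP (sub base)) \<one>\<^bsub>sub base\<^esub> 1) = up_of [:0, 1:]"
proof -
  interpret UP_cring "sub base" "UP (sub base)"
    using domain.axioms(1)[OF domain_D] by (auto intro: UP_cring.intro)
  have "up_ring.monom (UP (sub base)) \<one>\<^bsub>sub base\<^esub> 1 \<in> carrier (UP (sub base))"
    by (rule monom_closed) (rule R.one_closed)
  then have "poly_incl (sub base) (up_ring.monom (UP (sub base)) \<one>\<^bsub>sub base\<^esub> 1) =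
      up_ring.monom (UP (sub base)) \<one>\<^bsub>sub base\<^esub> 1"
    by (simp add: poly_incl_def)
  also have "\<dots> = (\<lambda>i. if i = 1 then e 1 else e 0)"
    using R.one_closed by (simp add: UP_def cong: if_cong)
  also have "\<dots> = up_of [:0, 1:]"
    by (auto simp: up_of_def coeff_pCons fun_eq_iff split: nat.splits)
  finally show ?thesis .
qed

theorem no_biring:
  fixes S :: "('u, 'u) module \<Rightarrow> ('u, (nat \<Rightarrow> 'u) \<Rightarrow> 'u) module"
  assumes S: "biring (sub base) IntD S"
    and j: "biring_hom (sub base) (UP (sub base)) (poly_lift (sub base)) IntD S (poly_incl (sub base))"
  shows False
proof -
  define h1 h2 where "h1 = (\<lambda>f\<in>carrier IntD. \<epsilon> (e' (f 0), e' (f 1), 0, 0))"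
    and "h2 = (\<lambda>f\<in>carrier IntD. \<epsilon> (e' (f 0), 0, e' (f 1), 0))"
  have h: "h1 \<in> alg_hom (sub base) IntD B" "h2 \<in> alg_hom (sub base) IntD B"
    unfolding h1_def h2_def
    using jet_alg_hom[of "\<lambda>a b. (a, b, 0, 0)"] jet_alg_hom[of "\<lambda>a b. (a, 0, b, 0)"]
    by (simp_all add: zero_in)
  have "up_of [:0, 1:] \<in> carrier IntD" unfolding carrier_int_valued by simp
  then have "h1 (up_of [:0, 1:]) = \<epsilon> (0, 1, 0, 0)" "h2 (up_of [:0, 1:]) = \<epsilon> (0, 0, 1, 0)"
    by (simp_all add: h1_def h2_def) (simp_all add: up_of_def)
  moreover obtain h where "h \<in> alg_hom (sub base) IntD B"
     "h (up_of [:0, 1:]) = h1 (up_of [:0, 1:]) \<oplus>\<^bsub>B\<^esub> h2 (up_of [:0, 1:])"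
    using biring_sum_at_X[OF S j algebra_B h] unfolding X_image by blast
  ultimately show False using no_hom_to_diagonal by simp
qed

end

theorem theorem3p4:
  assumes "infinite (UNIV :: 'u set)"
  shows "\<exists>(D :: 'u ring) (K :: 'u ring). domain D \<and> field_of_fractions D K \<and>
    \<not> (\<exists>S :: ('u, 'u) module \<Rightarrow> ('u, (nat \<Rightarrow> 'u) \<Rightarrow> 'u) module.
          biring D (int_valued D K) S \<and>
          biring_hom D (UP D) (poly_lift D) (int_valued D K) S (poly_incl D))"
proof -
  obtain c :: "nat \<Rightarrow> 'u" where c: "inj c"
    using assms infinite_countable_subset by blast
  have fract: "countable (UNIV :: int poly fract set)"
    by (rule countable_fract[OF countable_poly])
  then have "countable (UNIV :: (int poly fract \<times> int poly fract \<times> int poly fract \<times> int poly fract) set)"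
    unfolding UNIV_Times_UNIV[symmetric] by (intro countable_SIGMA)
  with fract obtain e0 :: "int poly fract \<Rightarrow> nat"
    and \<epsilon>0 :: "int poly fract \<times> int poly fract \<times> int poly fract \<times> int poly fract \<Rightarrow> nat"
    where "inj e0" "inj \<epsilon>0" by (auto simp: countable_def)
  with c have "inj (c \<circ> e0)" "inj (c \<circ> \<epsilon>0)" by (auto intro: inj_compose)
  then interpret counterexample int_poly_at_3 "c \<circ> e0" "c \<circ> \<epsilon>0"
    by (intro counterexample.intro infinite_residue_ring_int_poly transported_field.intro
        counterexample_axioms.intro)
  show ?thesis
    using domain_D field_of_fractions_D no_biring by blast
qed

end
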